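(* Let $G$ be a planar graph of order $n$. Then $$\tau(G) \leq 4(f(n/4)+1)-1\leq 4\lceil \log_2(n)\rceil-5.$$
   Context: The order of a graph is its number of vertices; $d_G(x,y)$ is the distance between $x$ and $y$ in $G$. A vertex $w$ resolves a pair of vertices $u,v$ if $d_G(u,w)\neq d_G(v,w)$. A set $W\subseteq V(G)$ is a resolving set for $G$ if every pair of distinct vertices of $G$ is resolved by some vertex of $W$. The metric dimension $\beta(G)$ is the minimum cardinality of a resolving set for $G$ (with the convention $\beta(K_1)=0$). The threshold dimension is $\tau(G)=\min\{\beta(H): H \text{ contains } G \text{ as a spanning subgraph}\}$, i.e. the minimum metric dimension among all graphs $H$ obtained from $G$ by adding edges (possibly none). The function $f:[1,\infty)\to\mathbb{N}$ is defined by letting $f(x)$ be the smallest integer $d$ such that $2^d+d>x$; i.e., $f(x)=d$ if and only if $x\in[2^{d-1}+d-1,\,2^d+d)$.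
   Formalization: The second inequality is false for n = 1, 2, 4 (at n = 4 it reads 7 ≤ 3), so it is stated only for n ≥ 3, n ≠ 4; τ(G) ≤ 4⌈log₂ n⌉ − 5 is stated for all n ≥ 3; f(x) is taken as 0 for x < 1. *)

theory Defs
  imports "HOL-Analysis.Analysis" "Graph_Theory.Graph_Theory"
begin

text \<open>
  A finite simple undirected graph is a \<open>pair_graph\<close>: a finite, loop-free, symmetric digraph
  without parallel arcs, an edge \<open>uv\<close> being the two arcs \<open>(u, v)\<close> and \<open>(v, u)\<close>.
\<close>

text \<open>
  The distance is \<open>\<infinity>\<close> between vertices in different components, so such a pair counts as
  having a distance different from every finite one.
\<close>

definition graph_dist :: "'a pair_pre_digraph \<Rightarrow> 'a \<Rightarrow> 'a \<Rightarrow> ereal" where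
  "graph_dist G u v = wf_digraph.\<mu> (with_proj G) (\<lambda>_. 1) u v"

definition resolves :: "'a pair_pre_digraph \<Rightarrow> 'a \<Rightarrow> 'a \<Rightarrow> 'a \<Rightarrow> bool" where
  "resolves G w u v \<longleftrightarrow> graph_dist G u w \<noteq> graph_dist G v w"

definition resolving_set :: "'a pair_pre_digraph \<Rightarrow> 'a set \<Rightarrow> bool" where
  "resolving_set G W \<longleftrightarrow> W \<subseteq> pverts G \<and>
     (\<forall>u \<in> pverts G. \<forall>v \<in> pverts G. u \<noteq> v \<longrightarrow> (\<exists>w \<in> W. resolves G w u v))"

definition metric_dimension :: "'a pair_pre_digraph \<Rightarrow> nat" where
  "metric_dimension G = (LEAST k. \<exists>W. resolving_set G W \<and> card W = k)"

definition threshold_dimension :: "'a pair_pre_digraph \<Rightarrow> nat" where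
  "threshold_dimension G =
     (LEAST k. \<exists>H. pair_graph H \<and> spanning (with_proj G) (with_proj H) \<and> metric_dimension H = k)"

text \<open>
  Topological drawings in the plane (\<open>complex\<close>): \<open>p\<close> places the vertices, and \<open>c\<close>, indexed by
  the undirected edge \<open>{u, v}\<close> so that both arcs of an edge share one curve, draws the edges
  as Jordan arcs, which may meet each other and the vertices only at common end points.
\<close>

definition plane_drawing ::
    "'a pair_pre_digraph \<Rightarrow> ('a \<Rightarrow> complex) \<Rightarrow> ('a set \<Rightarrow> real \<Rightarrow> complex) \<Rightarrow> bool" where
  "plane_drawing G p c \<longleftrightarrow>
     inj_on p (pverts G) \<and>
     (\<forall>(u, v) \<in> parcs G.
        arc (c {u, v}) \<and>
        {pathstart (c {u, v}), pathfinish (c {u, v})} = {p u, p v} \<and>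
        path_image (c {u, v}) \<inter> p ` pverts G = {p u, p v}) \<and>
     (\<forall>(u, v) \<in> parcs G. \<forall>(x, y) \<in> parcs G. {u, v} \<noteq> {x, y} \<longrightarrow>
        path_image (c {u, v}) \<inter> path_image (c {x, y}) \<subseteq> p ` ({u, v} \<inter> {x, y}))"

definition planar :: "'a pair_pre_digraph \<Rightarrow> bool" where
  "planar G \<longleftrightarrow> (\<exists>p c. plane_drawing G p c)"

text \<open>
  Intended for \<open>x \<ge> 1\<close>. For \<open>0 \<le> x < 1\<close> the same formula gives \<open>0\<close>, which is also the smallest
  integer \<open>d\<close> with \<open>2\<^sup>d + d > x\<close>, negative integers included.
\<close>

definition f_thr :: "real \<Rightarrow> nat" where
  "f_thr x = (LEAST d. 2 ^ d + real d > x)"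

end

theory Submission
  imports Defs
begin

text \<open>
  The four colour theorem is not needed; the only property of planar graphs used is that they
  have no subgraph \<open>K\<^sub>3\<^sub>,\<^sub>3\<close>.

  Put \<open>k = f (n/4)\<close>, so that \<open>n < 4 (2\<^sup>k + k)\<close>, and choose a set \<open>W\<close> of \<open>4 k + 3\<close> vertices. If edges
  between \<open>W\<close> and its complement can be added so that the vertices outside \<open>W\<close> have pairwise distinct
  neighbourhoods in \<open>W\<close>, then \<open>W\<close> resolves the new graph: vertices of \<open>W\<close> resolve themselves, and
  any other pair is resolved by a vertex adjacent to exactly one of the two. Equivalently, one has to
  choose distinct subsets of the sets \<open>D v\<close> of non-neighbours of \<open>v\<close> in \<open>W\<close>. Choosing greedily by
  increasing size of \<open>D v\<close>, this works as soon as, for each \<open>j\<close>, at most \<open>2\<^sup>j\<close> of the sets have at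
  most \<open>j\<close> elements. For \<open>j \<ge> k + 2\<close> there are fewer than \<open>2\<^sup>j\<close> vertices outside \<open>W\<close>; for smaller \<open>j\<close>
  three vertices with few non-neighbours would have three common neighbours in \<open>W\<close>.

  In a drawing of \<open>K\<^sub>3\<^sub>,\<^sub>3\<close>, two vertices of one side and the three paths between them form a theta
  curve, and the open star around the third vertex is a connected set in the complement of the theta
  curve that touches the interior of all three paths. If one path runs inside the cycle of the other
  two, it splits the interior of that cycle into two faces, neither of which touches all three paths;
  the remaining case is reduced to this one by an inversion centred inside the cycle.
\<close>

hide_const (open) Digraph_Component.connected

section \<open>Theta curves and the graph \<open>K\<^sub>3\<^sub>,\<^sub>3\<close>\<close>

lemma connected_subset_inside:
  fixes T C :: "complex set"
  assumes "connected T" "T \<inter> C = {}" "T \<inter> inside C \<noteq> {}"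
  shows "T \<subseteq> inside C"
  using inside_outside_intersect_connected[of T C] assms inside_Un_outside[of C] by blast

definition theta_curve ::
    "(real \<Rightarrow> complex) \<Rightarrow> (real \<Rightarrow> complex) \<Rightarrow> (real \<Rightarrow> complex) \<Rightarrow> complex \<Rightarrow> complex \<Rightarrow> bool" where
  "theta_curve c1 c2 c3 a b \<longleftrightarrow> a \<noteq> b \<and>
     (\<forall>c \<in> {c1, c2, c3}. simple_path c \<and> pathstart c = a \<and> pathfinish c = b) \<and>
     path_image c1 \<inter> path_image c2 = {a, b} \<and>
     path_image c1 \<inter> path_image c3 = {a, b} \<and>
     path_image c2 \<inter> path_image c3 = {a, b}"

text \<open>The closure lets a set disjoint from the path reach it. The end points are left out
  because in a theta curve they belong to all three paths.\<close>

definition touches :: "complex set \<Rightarrow> (real \<Rightarrow> complex) \<Rightarrow> bool" where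
  "touches S c \<longleftrightarrow> closure S \<inter> (path_image c - {pathstart c, pathfinish c}) \<noteq> {}"

text \<open>A touching point lies in the closure of \<open>S\<close>, so adding it keeps
  \<open>S\<close> connected, and the path without its end points is a connected set through that
  point.\<close>

lemma connected_Un_touched:
  assumes "connected S" "simple_path c" "touches S c"
  shows "connected (S \<union> (path_image c - {pathstart c, pathfinish c}))"
proof -
  obtain x where x: "x \<in> closure S" "x \<in> path_image c - {pathstart c, pathfinish c}"
    using assms(3) unfolding touches_def by blast
  have "connected (insert x S)"
    using connected_intermediate_closure[OF assms(1), of "insert x S"] x(1) closure_subset by blast
  then have "connected (insert x S \<union> (path_image c - {pathstart c, pathfinish c}))"
    using connected_simple_path_endless[OF assms(2)] x(2) by (intro connected_Un) auto
  moreover have "insert x S \<union> (path_image c - {pathstart c, pathfinish c})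
      = S \<union> (path_image c - {pathstart c, pathfinish c})"
    using x(2) by blast
  ultimately show ?thesis by simp
qed

text \<open>Attaching the open path \<open>c3\<close> to \<open>S\<close> forces \<open>S\<close>
  into the inside of the cycle of \<open>c1\<close> and \<open>c2\<close>, hence into one of the two
  parts separated by \<open>c3\<close>. If that part is bounded by \<open>c1\<close> and
  \<open>c3\<close>, attaching the open path \<open>c2\<close> to \<open>S\<close> drags
  \<open>c2\<close> into the inside of a cycle on which it lies; the other part is
  symmetric.\<close>

lemma theta_curve_third_path_not_inside:
  assumes theta: "theta_curve c1 c2 c3 a b"
    and S: "connected S" "S \<inter> (path_image c1 \<union> path_image c2 \<union> path_image c3) = {}"
    and touch: "touches S c1" "touches S c2" "touches S c3"
  shows "path_image c3 \<inter> inside (path_image c1 \<union> path_image c2) = {}"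
proof (rule ccontr)
  assume ne: "path_image c3 \<inter> inside (path_image c1 \<union> path_image c2) \<noteq> {}"
  note th = theta[unfolded theta_curve_def]
  let ?P = "\<lambda>c. path_image c - {a, b}"
  have con: "connected (S \<union> ?P c)" if "c \<in> {c1, c2, c3}" for c
    using connected_Un_touched[OF S(1), of c] th touch that by auto
  have nemp: "?P c \<noteq> {}" if "c \<in> {c1, c2, c3}" for c
    using nonempty_simple_path_endless[of c] th that by auto
  have "S \<noteq> {}" using touch(1) by (auto simp: touches_def)
  obtain split1: "inside (path_image c1 \<union> path_image c3) \<inter> inside (path_image c2 \<union> path_image c3) = {}"
    and split2: "inside (path_image c1 \<union> path_image c3) \<union> inside (path_image c2 \<union> path_image c3) \<union>
        ?P c3 = inside (path_image c1 \<union> path_image c2)"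
    using split_inside_simple_closed_curve[of c1 a b c2 c3] th ne by auto
  have no: "inside C \<inter> C = {}" for C :: "complex set"
    by (simp add: inside_no_overlap)
  have "(S \<union> ?P c3) \<inter> (path_image c1 \<union> path_image c2) = {}"
    using S(2) th by blast
  moreover have "(S \<union> ?P c3) \<inter> inside (path_image c1 \<union> path_image c2) \<noteq> {}"
  proof -
    obtain x where x: "x \<in> path_image c3" "x \<in> inside (path_image c1 \<union> path_image c2)"
      using ne by blast
    moreover have "{a, b} \<subseteq> path_image c1" using th by blast
    ultimately show ?thesis using no[of "path_image c1 \<union> path_image c2"] by blast
  qed
  ultimately have "S \<subseteq> inside (path_image c1 \<union> path_image c2)"
    using connected_subset_inside[OF con[of c3]] by blast
  then obtain z where z: "z \<in> S"
      "z \<in> inside (path_image c1 \<union> path_image c3) \<or> z \<in> inside (path_image c2 \<union> path_image c3)"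
    using split2 S(2) \<open>S \<noteq> {}\<close> by blast
  from z(2) show False
  proof
    assume *: "z \<in> inside (path_image c1 \<union> path_image c3)"
    have "(S \<union> ?P c2) \<inter> (path_image c1 \<union> path_image c3) = {}"
      using S(2) th by blast
    then have "?P c2 \<subseteq> inside (path_image c1 \<union> path_image c3)"
      using connected_subset_inside[OF con[of c2]] * z(1) by blast
    then show False
      using split2 nemp[of c2] no[of "path_image c1 \<union> path_image c2"] by blast
  next
    assume *: "z \<in> inside (path_image c2 \<union> path_image c3)"
    have "(S \<union> ?P c1) \<inter> (path_image c2 \<union> path_image c3) = {}"
      using S(2) th by blast
    then have "?P c1 \<subseteq> inside (path_image c2 \<union> path_image c3)"
      using connected_subset_inside[OF con[of c1]] * z(1) by blast
    then show False
      using split2 nemp[of c1] no[of "path_image c1 \<union> path_image c2"] by blast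
  qed
qed

text \<open>The outside is connected and its image avoids the image of the curve, so one point
  mapped into the new inside suffices. A nonzero point there has a preimage that cannot lie in the
  old inside: otherwise the punctured inside would have a bounded image, although
  \<open>\<phi>\<close> is unbounded near \<open>q\<close>.\<close>

lemma inversion_outside_subset_inside:
  fixes q :: complex
  assumes c: "simple_path c" "pathfinish c = pathstart c" and q: "q \<in> inside (path_image c)"
  defines "\<phi> \<equiv> \<lambda>x. inverse (x - q)"
  shows "\<phi> ` outside (path_image c) \<subseteq> inside (\<phi> ` path_image c)"
proof -
  let ?C = "path_image c"
  note J = Jordan_inside_outside[OF c]
  have qC: "q \<notin> ?C" using q inside_no_overlap[of ?C] by blast
  have qout: "q \<notin> outside ?C" using q inside_Int_outside[of ?C] by blast
  have inj: "inj \<phi>" by (auto simp: \<phi>_def inj_on_def)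
  have disj: "\<phi> ` X \<inter> \<phi> ` Y = {}" if "X \<inter> Y = {}" for X Y
    using image_Int[OF inj, of X Y] that by simp
  have cont: "continuous_on X \<phi>" if "q \<notin> X" for X
    unfolding \<phi>_def using that by (intro continuous_intros) auto
  obtain e where e: "e > 0" "ball q e \<subseteq> inside ?C"
    using J q by (meson open_contains_ball)
  have sp: "simple_path (\<phi> \<circ> c)" "pathfinish (\<phi> \<circ> c) = pathstart (\<phi> \<circ> c)"
    using simple_path_continuous_image[OF c(1) cont[OF qC]] inj c(2)
    by (auto simp: inj_on_def pathfinish_def pathstart_def)
  note J' = Jordan_inside_outside[OF sp, unfolded path_image_compose]
  \<comment> \<open>As \<open>inverse 0 = 0\<close>, the point 0 has only \<open>q\<close> as
    preimage and must be avoided; an open set is never a singleton.\<close>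
  have "inside (\<phi> ` ?C) \<noteq> {0}"
    using J' not_open_singleton by metis
  then obtain y where y: "y \<in> inside (\<phi> ` ?C)" "y \<noteq> 0" using J' by blast
  define x where "x = q + inverse y"
  have x: "\<phi> x = y" "x \<noteq> q" using y(2) by (auto simp: \<phi>_def x_def)
  have "x \<notin> ?C" using x(1) y(1) inside_no_overlap[of "\<phi> ` ?C"] by blast
  have "x \<notin> inside ?C"
  proof
    assume xin: "x \<in> inside ?C"
    have "connected (inside ?C - {q})"
      using J by (intro connected_open_diff_countable) auto
    then have "connected (\<phi> ` (inside ?C - {q}))"
      by (intro connected_continuous_image cont) auto
    moreover have "\<phi> ` (inside ?C - {q}) \<inter> \<phi> ` ?C = {}"
      using inside_no_overlap[of ?C] by (intro disj) blast
    moreover have "\<phi> ` (inside ?C - {q}) \<inter> inside (\<phi> ` ?C) \<noteq> {}"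
      using x xin y(1) by auto
    ultimately have "\<phi> ` (inside ?C - {q}) \<subseteq> inside (\<phi> ` ?C)"
      by (rule connected_subset_inside)
    then have "bounded (\<phi> ` (inside ?C - {q}))"
      using J' bounded_subset by blast
    then obtain B where B: "B > 0" "\<And>w. w \<in> inside ?C - {q} \<Longrightarrow> norm (\<phi> w) \<le> B"
      unfolding bounded_pos by auto
    \<comment> \<open>The bound by \<open>e\<close> keeps \<open>q + t\<close> inside the curve; the
      bound by \<open>inverse (B + 1)\<close> gives its image norm at least
      \<open>B + 1\<close>.\<close>
    define t where "t = min (e / 2) (inverse (B + 1))"
    have t: "t > 0" "t < e" "t \<le> inverse (B + 1)"
      using e B(1) by (auto simp: t_def)
    have "q + of_real t \<in> ball q e" using t by (simp add: dist_norm)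
    then have "q + of_real t \<in> inside ?C - {q}" using e(2) t(1) by (simp add: subset_iff)
    then have "inverse t \<le> B"
      using B(2)[of "q + of_real t"] t(1) by (simp add: \<phi>_def norm_inverse)
    moreover have "B + 1 \<le> inverse t"
      using le_imp_inverse_le[OF t(3) t(1)] by simp
    ultimately show False by simp
  qed
  then have "x \<in> outside ?C" using \<open>x \<notin> ?C\<close> inside_Un_outside[of ?C] by blast
  then have "\<phi> ` outside ?C \<inter> inside (\<phi> ` ?C) \<noteq> {}" using x y by auto
  moreover have "\<phi> ` outside ?C \<inter> \<phi> ` ?C = {}"
    using outside_no_overlap[of ?C] by (intro disj) blast
  moreover have "connected (\<phi> ` outside ?C)"
    using J qout by (intro connected_continuous_image cont) auto
  ultimately show ?thesis by (intro connected_subset_inside)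
qed

text \<open>Since \<open>c3\<close> does not run inside the cycle of \<open>c1\<close> and
  \<open>c2\<close>, both \<open>S\<close> and the open path \<open>c3\<close> lie outside it.
  Inversion at a point inside the cycle preserves the theta curve and the touching, but moves
  \<open>c3\<close> into the inside of the image cycle, which is impossible for the same
  reason.\<close>

lemma theta_curve_no_common_face:
  assumes theta: "theta_curve c1 c2 c3 a b"
    and S: "connected S" "S \<inter> (path_image c1 \<union> path_image c2 \<union> path_image c3) = {}"
    and touch: "touches S c1" "touches S c2" "touches S c3"
  shows False
proof -
  note th = theta[unfolded theta_curve_def]
  let ?C = "path_image c1 \<union> path_image c2"
  let ?P = "path_image c3 - {a, b}"
  have no: "path_image c3 \<inter> inside ?C = {}"
    by (rule theta_curve_third_path_not_inside[OF assms])
  have arcs: "arc c1" "arc c2" using th by (auto simp: arc_simple_path)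
  define d where "d = c1 +++ reversepath c2"
  have d: "simple_path d" "pathfinish d = pathstart d" "path_image d = ?C"
    using th arcs by (auto simp: d_def path_image_join simple_path_join_loop_eq arc_reversepath)
  obtain q where q: "q \<in> inside ?C" using Jordan_inside_outside[OF d(1,2)] d(3) by auto
  define \<phi> where "\<phi> = (\<lambda>x. inverse (x - q))"
  have inj: "inj \<phi>" by (auto simp: \<phi>_def inj_on_def)
  have nemp: "?P \<noteq> {}"
    using nonempty_simple_path_endless[of c3] th by auto
  have con: "connected (S \<union> ?P)"
    using connected_Un_touched[OF S(1), of c3] th touch by auto
  have disj: "(S \<union> ?P) \<inter> ?C = {}" using S(2) th by blast
  have "\<not> S \<union> ?P \<subseteq> inside ?C" using no nemp by blast
  then have "(S \<union> ?P) \<inter> inside ?C = {}"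
    using connected_subset_inside[OF con disj] by blast
  then have out: "S \<union> ?P \<subseteq> outside ?C" and qS: "q \<notin> S"
    using disj inside_Un_outside[of ?C] q by blast+
  have qc: "q \<notin> path_image c" if "c \<in> {c1, c2, c3}" for c
    using that q no inside_no_overlap[of ?C] by blast
  have cont: "continuous_on X \<phi>" if "q \<notin> X" for X
    unfolding \<phi>_def using that by (intro continuous_intros) auto
  have theta': "theta_curve (\<phi> \<circ> c1) (\<phi> \<circ> c2) (\<phi> \<circ> c3) (\<phi> a) (\<phi> b)"
  proof -
    have "simple_path (\<phi> \<circ> c) \<and> pathstart (\<phi> \<circ> c) = \<phi> a \<and> pathfinish (\<phi> \<circ> c) = \<phi> b"
      if "c \<in> {c1, c2, c3}" for c
      using simple_path_continuous_image[OF _ cont[OF qc[OF that]]] th that inj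
      by (auto simp: pathstart_compose pathfinish_compose inj_on_def)
    moreover have "\<phi> a \<noteq> \<phi> b" using th inj by (simp add: inj_eq)
    moreover have "\<phi> ` X \<inter> \<phi> ` Y = {\<phi> a, \<phi> b}" if "X \<inter> Y = {a, b}" for X Y
      using image_Int[OF inj, of X Y] that by simp
    ultimately show ?thesis using th unfolding theta_curve_def path_image_compose by auto
  qed
  have touch': "touches (\<phi> ` S) (\<phi> \<circ> c)" if "c \<in> {c1, c2, c3}" for c
  proof -
    have "touches S c" using touch that by auto
    then obtain x where x: "x \<in> closure S" "x \<in> path_image c" "x \<noteq> pathstart c" "x \<noteq> pathfinish c"
      unfolding touches_def by blast
    have "x \<noteq> q" using x(2) qc[OF that] by auto
    then have "isCont \<phi> x" unfolding \<phi>_def by (intro continuous_intros) auto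
    moreover obtain s where s: "\<And>n. s n \<in> S" "s \<longlonglongrightarrow> x"
      using x(1) unfolding closure_sequential by blast
    ultimately have "(\<lambda>n. \<phi> (s n)) \<longlonglongrightarrow> \<phi> x" by (auto intro: isCont_tendsto_compose)
    moreover have "\<phi> (s n) \<in> \<phi> ` S" for n using s(1) by blast
    ultimately have "\<phi> x \<in> closure (\<phi> ` S)"
      unfolding closure_sequential by (intro exI[of _ "\<lambda>n. \<phi> (s n)"]) blast
    then have "\<phi> x \<in> closure (\<phi> ` S) \<inter> (\<phi> ` path_image c - {\<phi> (pathstart c), \<phi> (pathfinish c)})"
      using x(2-4) by (simp add: inj_eq[OF inj])
    then show ?thesis
      unfolding touches_def path_image_compose pathstart_compose pathfinish_compose by blast
  qed
  have "\<phi> ` outside ?C \<subseteq> inside (\<phi> ` ?C)"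
    using inversion_outside_subset_inside[OF d(1,2)] q d(3) unfolding \<phi>_def by simp
  then have "path_image (\<phi> \<circ> c3) \<inter> inside (path_image (\<phi> \<circ> c1) \<union> path_image (\<phi> \<circ> c2)) \<noteq> {}"
  proof -
    obtain x where x: "x \<in> ?P" using nemp by blast
    then have "\<phi> x \<in> inside (\<phi> ` ?C)"
      using out \<open>\<phi> ` outside ?C \<subseteq> inside (\<phi> ` ?C)\<close> by blast
    then show ?thesis using x by (auto simp: path_image_compose image_Un)
  qed
  moreover have "path_image (\<phi> \<circ> c3) \<inter> inside (path_image (\<phi> \<circ> c1) \<union> path_image (\<phi> \<circ> c2)) = {}"
  proof (rule theta_curve_third_path_not_inside[OF theta'])
    show "connected (\<phi> ` S)" using S(1) cont[OF qS] by (intro connected_continuous_image)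
    show "\<phi> ` S \<inter> (path_image (\<phi> \<circ> c1) \<union> path_image (\<phi> \<circ> c2) \<union> path_image (\<phi> \<circ> c3)) = {}"
      using S(2) inj by (auto simp: path_image_compose inj_eq)
  qed (use touch' in auto)
  ultimately show False by blast
qed

section \<open>Plane drawings of \<open>K\<^sub>3\<^sub>,\<^sub>3\<close>\<close>

text \<open>One curve serves both arcs of an edge, so its direction is arbitrary and may have to be
  reversed.\<close>

lemma plane_drawing_oriented_arc:
  assumes "plane_drawing G p c" "(u, v) \<in> parcs G"
  obtains g where "arc g" "pathstart g = p u" "pathfinish g = p v"
    "path_image g = path_image (c {u, v})"
proof -
  have a: "arc (c {u, v})" "{pathstart (c {u, v}), pathfinish (c {u, v})} = {p u, p v}"
    using assms unfolding plane_drawing_def by auto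
  show ?thesis
  proof (cases "pathstart (c {u, v}) = p u")
    case True
    then have "pathfinish (c {u, v}) = p v" using a(2) by (auto simp: doubleton_eq_iff)
    then show ?thesis using that[of "c {u, v}"] a(1) True by simp
  next
    case False
    then have "pathstart (c {u, v}) = p v" "pathfinish (c {u, v}) = p u"
      using a(2) by (auto simp: doubleton_eq_iff)
    then show ?thesis using that[of "reversepath (c {u, v})"] a(1) by (simp add: arc_reversepath)
  qed
qed

lemma planar_no_K33:
  assumes "planar G" and wf: "parcs G \<subseteq> pverts G \<times> pverts G"
    and cA: "card A = 3" and cB: "card B = 3" and AB: "A \<inter> B = {}"
    and arcs: "A \<times> B \<subseteq> parcs G"
  shows False
proof -
  obtain p c where pd: "plane_drawing G p c" using assms(1) unfolding planar_def by blast
  have injp: "inj_on p (pverts G)" using pd unfolding plane_drawing_def by blast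
  have meet: "path_image (c {u, v}) \<inter> path_image (c {x, y}) \<subseteq> p ` ({u, v} \<inter> {x, y})"
    if "(u, v) \<in> parcs G" "(x, y) \<in> parcs G" "{u, v} \<noteq> {x, y}" for u v x y
    using pd that unfolding plane_drawing_def by blast
  have vert: "path_image (c {u, v}) \<inter> p ` pverts G = {p u, p v}" if "(u, v) \<in> parcs G" for u v
    using pd that unfolding plane_drawing_def by blast
  have sub: "A \<subseteq> pverts G" "B \<subseteq> pverts G"
  proof -
    have "A \<noteq> {}" "B \<noteq> {}" using cA cB by auto
    then show "A \<subseteq> pverts G" "B \<subseteq> pverts G" using arcs wf by blast+
  qed
  obtain a1 a2 a3 where A: "A = {a1, a2, a3}" "a1 \<noteq> a2" "a1 \<noteq> a3" "a2 \<noteq> a3"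
    using cA by (auto simp: card_3_iff)
  obtain b1 b2 b3 where B: "B = {b1, b2, b3}" "b1 \<noteq> b2" "b1 \<noteq> b3" "b2 \<noteq> b3"
    using cB by (auto simp: card_3_iff)
  define E where "E a b = path_image (c {a, b})" for a b
  have pne: "p x \<noteq> p y" if "x \<in> A \<union> B" "y \<in> A \<union> B" "x \<noteq> y" for x y
    using injp that sub by (auto simp: inj_on_def)
  have Emeet: "E a b \<inter> E a' b' \<subseteq> p ` ({a, b} \<inter> {a', b'})"
    if "a \<in> A" "a' \<in> A" "b \<in> B" "b' \<in> B" "a \<noteq> a' \<or> b \<noteq> b'" for a b a' b'
    unfolding E_def using that arcs AB by (intro meet) (auto simp: doubleton_eq_iff)
  have "\<exists>g. arc g \<and> pathstart g = p a \<and> pathfinish g = p b \<and> path_image g = E a b"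
    if "a \<in> A" "b \<in> B" for a b
    using plane_drawing_oriented_arc[OF pd, of a b] arcs that unfolding E_def by blast
  then obtain g where g: "\<And>a b. a \<in> A \<Longrightarrow> b \<in> B \<Longrightarrow> arc (g a b) \<and> pathstart (g a b) = p a \<and>
      pathfinish (g a b) = p b \<and> path_image (g a b) = E a b"
    by metis
  have ends: "p a \<in> E a b" "p b \<in> E a b" if "a \<in> A" "b \<in> B" for a b
    using g[OF that] pathstart_in_path_image pathfinish_in_path_image by metis+
  \<comment> \<open>The path from \<open>a1\<close> to \<open>a2\<close> through \<open>b\<close>;
    the three choices of \<open>b\<close> give the theta curve.\<close>
  define d where "d b = g a1 b +++ reversepath (g a2 b)" for b
  have d: "simple_path (d b)" "pathstart (d b) = p a1" "pathfinish (d b) = p a2"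
      "path_image (d b) = E a1 b \<union> E a2 b" if b: "b \<in> B" for b
  proof -
    have "E a1 b \<inter> E a2 b \<subseteq> {p b}"
      using Emeet[of a1 a2 b b] A B b by auto
    then have "arc (d b)"
      using g[of a1 b] g[of a2 b] A b unfolding d_def
      by (intro arc_join) (auto simp: arc_reversepath)
    then show "simple_path (d b)" by (rule arc_imp_simple_path)
    show "pathstart (d b) = p a1" "pathfinish (d b) = p a2"
      "path_image (d b) = E a1 b \<union> E a2 b"
      using g[of a1 b] g[of a2 b] A b by (auto simp: d_def path_image_join)
  qed
  have dmeet: "path_image (d b) \<inter> path_image (d b') = {p a1, p a2}"
    if "b \<in> B" "b' \<in> B" "b \<noteq> b'" for b b'
  proof -
    have "x \<in> {p a1, p a2}"
      if "a \<in> {a1, a2}" "a' \<in> {a1, a2}" "x \<in> E a b" "x \<in> E a' b'" for x a a'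
    proof -
      have "x \<in> p ` ({a, b} \<inter> {a', b'})"
        using Emeet[of a a' b b'] that \<open>b \<in> B\<close> \<open>b' \<in> B\<close> \<open>b \<noteq> b'\<close> A by blast
      moreover have "{a, b} \<inter> {a', b'} \<subseteq> {a1, a2}"
        using that \<open>b \<in> B\<close> \<open>b' \<in> B\<close> \<open>b \<noteq> b'\<close> A AB by auto
      ultimately show ?thesis by blast
    qed
    then show ?thesis
      using d(4)[OF that(1)] d(4)[OF that(2)] ends[of a1] ends[of a2] A that by auto
  qed
  have theta: "theta_curve (d b1) (d b2) (d b3) (p a1) (p a2)"
    unfolding theta_curve_def using dmeet d B pne[of a1 a2] A by auto
  \<comment> \<open>The star of \<open>a3\<close> is built from half-open edges: without the points
    \<open>p b\<close> it misses the theta curve, yet its closure contains them.\<close>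
  define S where "S = (\<Union>b\<in>B. g a3 b ` {0..<1})"
  have a3: "a3 \<in> A" using A by simp
  have cg: "continuous_on {0..1} (g a3 b)" "inj_on (g a3 b) {0..1}" if "b \<in> B" for b
    using g[OF a3 that] by (auto simp: arc_def path_def)
  have "connected S"
    unfolding S_def
  proof (rule connected_Union)
    show "connected X" if X: "X \<in> (\<lambda>b. g a3 b ` {0..<1}) ` B" for X
    proof -
      obtain b where b: "b \<in> B" "X = g a3 b ` {0..<1}" using X by blast
      show ?thesis unfolding b(2)
        by (rule connected_continuous_image[OF continuous_on_subset[OF cg(1)[OF b(1)]]]) auto
    qed
    have "p a3 \<in> g a3 b ` {0..<1}" if "b \<in> B" for b
      using g[OF a3 that] by (auto simp: pathstart_def intro!: image_eqI[of _ _ 0])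
    then show "\<Inter> ((\<lambda>b. g a3 b ` {0..<1}) ` B) \<noteq> {}" by auto
  qed
  have Ssub: "x \<in> E a3 b - {p b}" if bB: "b \<in> B" and xg: "x \<in> g a3 b ` {0..<1}" for x b
  proof -
    obtain t where t: "0 \<le> t" "t < 1" "x = g a3 b t" using xg by auto
    have "g a3 b t \<noteq> g a3 b 1" using inj_onD[OF cg(2)[OF bB], of t 1] t by auto
    moreover have "g a3 b 1 = p b" "E a3 b = g a3 b ` {0..1}"
      using g[OF a3 bB] by (auto simp: pathfinish_def path_image_def)
    ultimately show ?thesis using t by auto
  qed
  have Sd: "S \<inter> path_image (d b') = {}" if b': "b' \<in> B" for b'
  proof -
    have False if "b \<in> B" "x \<in> g a3 b ` {0..<1}" "a \<in> {a1, a2}" "x \<in> E a b'" for x a b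
    proof -
      have "x \<in> E a3 b" "x \<noteq> p b" using Ssub that by auto
      moreover have "E a3 b \<inter> E a b' \<subseteq> p ` ({a3, b} \<inter> {a, b'})"
        using that b' A by (intro Emeet) auto
      moreover have "{a3, b} \<inter> {a, b'} \<subseteq> {b}" using that b' A AB by auto
      ultimately show False using that by blast
    qed
    then show ?thesis using d(4)[OF b'] unfolding S_def by blast
  qed
  have "touches S (d b)" if b: "b \<in> B" for b
  proof -
    have "g a3 b ` closure {0..<1} \<subseteq> closure (g a3 b ` {0..<1})"
    proof (rule image_closure_subset)
      show "continuous_on (closure {0..<1}) (g a3 b)" using cg(1)[OF b] by simp
    qed (simp_all add: closure_subset)
    moreover have "p b = g a3 b 1" using g[OF a3 b] by (simp add: pathfinish_def)
    ultimately have "p b \<in> closure (g a3 b ` {0..<1})" by (simp add: image_subset_iff)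
    then have "p b \<in> closure S"
      using closure_mono[of "g a3 b ` {0..<1}" S] b unfolding S_def by blast
    moreover have "p b \<in> path_image (d b)" "p b \<noteq> p a1" "p b \<noteq> p a2"
      using d(4)[OF b] ends[of a1 b] b pne[of b a1] pne[of b a2] A AB by auto
    ultimately show ?thesis using d[OF b] unfolding touches_def by auto
  qed
  then show False
    using theta_curve_no_common_face[OF theta \<open>connected S\<close>] Sd B by auto
qed

section \<open>Resolving sets in supergraphs\<close>

text \<open>Induction on \<open>card T\<close>, removing some \<open>v\<close> with
  \<open>D v\<close> largest. The other elements use at most \<open>card T - 1\<close> subsets,
  while the hypothesis at \<open>j = card (D v)\<close> gives
  \<open>card T \<le> 2 ^ card (D v)\<close>, so some subset of \<open>D v\<close> is still
  free.\<close>

lemma distinct_subsets_exist: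
  fixes D :: "'a \<Rightarrow> 'b set"
  assumes "finite T" "\<And>v. v \<in> T \<Longrightarrow> finite (D v)"
    and "\<And>j. card {v \<in> T. card (D v) \<le> j} \<le> 2 ^ j"
  shows "\<exists>C. inj_on C T \<and> (\<forall>v \<in> T. C v \<subseteq> D v)"
  using assms
proof (induction "card T" arbitrary: T)
  case 0
  then show ?case by auto
next
  case (Suc n)
  have "T \<noteq> {}" using Suc.hyps(2) by auto
  have "Max ((\<lambda>v. card (D v)) ` T) \<in> (\<lambda>v. card (D v)) ` T"
    using \<open>T \<noteq> {}\<close> Suc.prems(1) by (intro Max_in) auto
  then obtain v where v: "v \<in> T" "card (D v) = Max ((\<lambda>v. card (D v)) ` T)" by auto
  have mx: "card (D u) \<le> card (D v)" if "u \<in> T" for u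
    using that v Suc.prems(1) by (auto intro: Max_ge)
  have "\<exists>C. inj_on C (T - {v}) \<and> (\<forall>u \<in> T - {v}. C u \<subseteq> D u)"
  proof (rule Suc.hyps(1))
    show "n = card (T - {v})" using Suc.hyps(2) v(1) Suc.prems(1) by simp
    show "card {u \<in> T - {v}. card (D u) \<le> j} \<le> 2 ^ j" for j
      using Suc.prems(1) by (intro order.trans[OF card_mono Suc.prems(3)[of j]]) auto
  qed (use Suc.prems in auto)
  then obtain C where C: "inj_on C (T - {v})" "\<forall>u \<in> T - {v}. C u \<subseteq> D u" by blast
  have "card (C ` (T - {v})) \<le> card (T - {v})"
    using Suc.prems(1) by (intro card_image_le) auto
  also have "\<dots> < card T" using v(1) Suc.prems(1) by (intro psubset_card_mono) auto
  also have "\<dots> \<le> 2 ^ card (D v)"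
  proof -
    have "{u \<in> T. card (D u) \<le> card (D v)} = T" using mx by blast
    then show ?thesis using Suc.prems(3)[of "card (D v)"] by simp
  qed
  also have "\<dots> = card (Pow (D v))" using Suc.prems(2) v(1) by (simp add: card_Pow)
  finally have "\<not> Pow (D v) \<subseteq> C ` (T - {v})"
    using Suc.prems(1) by (meson card_mono finite_Diff finite_imageI leD)
  then obtain X where X: "X \<subseteq> D v" "X \<notin> C ` (T - {v})" by blast
  have "inj_on (C(v := X)) T"
    using C(1) X(2) by (auto simp: inj_on_def)
  moreover have "\<forall>u \<in> T. (C(v := X)) u \<subseteq> D u" using C(2) X(1) by auto
  ultimately show ?case by blast
qed

section \<open>Distances and resolving sets\<close>

lemma graph_dist_self_le:
  assumes "pair_wf_digraph H" "u \<in> pverts H"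
  shows "graph_dist H u u \<le> 0"
proof -
  interpret pair_wf_digraph H by fact
  have "awalk u [] u" using assms(2) by (simp add: awalk_Nil_iff)
  then show ?thesis using min_cost_le_walk_cost[of u "[]" u "\<lambda>_. 1"]
    by (simp add: graph_dist_def zero_ereal_def)
qed

lemma graph_dist_arc_le:
  assumes "pair_wf_digraph H" "(u, v) \<in> parcs H"
  shows "graph_dist H u v \<le> 1"
proof -
  interpret pair_wf_digraph H by fact
  have "awalk u [(u, v)] v"
    using assms(2) in_arcsD2[OF assms(2)] by (simp add: awalk_Cons_iff awalk_Nil_iff)
  then show ?thesis using min_cost_le_walk_cost[of u "[(u, v)]" v "\<lambda>_. 1"]
    by (simp add: graph_dist_def one_ereal_def)
qed

lemma graph_dist_ge_1:
  assumes "pair_wf_digraph H" "u \<noteq> v"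
  shows "graph_dist H u v \<ge> 1"
proof -
  interpret pair_wf_digraph H by fact
  have "1 \<le> ereal (awalk_cost (\<lambda>_. 1) p)" if "awalk u p v" for p
    using that assms(2) by (cases p) (auto simp: awalk_Nil_iff awalk_cost_def sum_list_triv)
  then show ?thesis unfolding graph_dist_def \<mu>_def by (auto intro: INF_greatest)
qed

text \<open>A walk without arcs would give \<open>u = v\<close>, and a walk with one arc would be
  the arc \<open>(u, v)\<close>; if there is no walk at all, the distance is
  \<open>\<infinity>\<close>.\<close>

lemma graph_dist_ge_2:
  assumes "pair_wf_digraph H" "u \<noteq> v" "(u, v) \<notin> parcs H"
  shows "graph_dist H u v \<ge> 2"
proof -
  interpret pair_wf_digraph H by fact
  have "2 \<le> ereal (awalk_cost (\<lambda>_. 1) p)" if p: "awalk u p v" for p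
  proof (cases p)
    case Nil
    then show ?thesis using p assms(2) by (simp add: awalk_Nil_iff)
  next
    case (Cons e q)
    show ?thesis
    proof (cases q)
      case Nil
      then show ?thesis using p assms(3) Cons by (cases e) (simp add: awalk_Cons_iff awalk_Nil_iff)
    next
      case (Cons e' q')
      then show ?thesis using \<open>p = e # q\<close> by (auto simp: awalk_cost_def sum_list_triv)
    qed
  qed
  then show ?thesis unfolding graph_dist_def \<mu>_def by (auto intro: INF_greatest)
qed

lemma resolving_setI:
  assumes H: "pair_graph H" and W: "W \<subseteq> pverts H"
    and distinct: "\<And>u v. u \<in> pverts H - W \<Longrightarrow> v \<in> pverts H - W \<Longrightarrow> u \<noteq> v \<Longrightarrow>
      {w \<in> W. (u, w) \<in> parcs H} \<noteq> {w \<in> W. (v, w) \<in> parcs H}"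
  shows "resolving_set H W"
  unfolding resolving_set_def
proof (intro conjI ballI impI)
  fix u v assume uv: "u \<in> pverts H" "v \<in> pverts H" "u \<noteq> v"
  interpret pair_graph H by fact
  have wf: "pair_wf_digraph H" by unfold_locales
  have self: "resolves H x x y \<and> resolves H x y x" if "x \<in> pverts H" "x \<noteq> y" for x y
  proof -
    have "graph_dist H x x \<le> 0" by (rule graph_dist_self_le[OF wf that(1)])
    also have "(0::ereal) < 1" by simp
    also have "1 \<le> graph_dist H y x" using that(2) by (intro graph_dist_ge_1[OF wf]) auto
    finally have "graph_dist H x x < graph_dist H y x" .
    then show ?thesis by (auto simp: resolves_def)
  qed
  have adj: "resolves H w x y \<and> resolves H w y x"
    if "(x, w) \<in> parcs H" "(y, w) \<notin> parcs H" "y \<noteq> w" for w x y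
  proof -
    have "graph_dist H x w \<le> 1" "graph_dist H y w \<ge> 2"
      using graph_dist_arc_le[OF wf] graph_dist_ge_2[OF wf] that by auto
    moreover have "(1::ereal) < 2" by simp
    ultimately have "graph_dist H x w < graph_dist H y w" by (meson less_le_trans le_less_trans)
    then show ?thesis by (auto simp: resolves_def)
  qed
  show "\<exists>w \<in> W. resolves H w u v"
  proof (cases "u \<in> W \<or> v \<in> W")
    case True
    then show ?thesis using self[of u v] self[of v u] uv by auto
  next
    case False
    then obtain w where "w \<in> W" "((u, w) \<in> parcs H) \<noteq> ((v, w) \<in> parcs H)"
      using distinct[of u v] uv by blast
    then show ?thesis using adj[of u w v] adj[of v w u] False by blast
  qed
qed (rule W)

section \<open>Bounding the threshold dimension by adding edges\<close>

lemma threshold_dimension_le: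
  assumes "pair_graph H" "spanning (with_proj G) (with_proj H)" "resolving_set H W"
  shows "threshold_dimension G \<le> card W"
proof -
  have "threshold_dimension G \<le> metric_dimension H"
    unfolding threshold_dimension_def using assms(1,2) by (intro Least_le) blast
  also have "\<dots> \<le> card W"
    unfolding metric_dimension_def using assms(3) by (intro Least_le) blast
  finally show ?thesis .
qed

text \<open>The counting hypothesis yields distinct sets \<open>C v\<close> of non-neighbours of
  \<open>v\<close> in \<open>W\<close>; they become the sets of vertices of \<open>W\<close> still
  not adjacent to \<open>v\<close> in the supergraph.\<close>

lemma threshold_dimension_le_of_few_nonneighbours:
  assumes G: "pair_graph G" and W: "W \<subseteq> pverts G"
    and few: "\<And>j. card {v \<in> pverts G - W. card {w \<in> W. (v, w) \<notin> parcs G} \<le> j} \<le> 2 ^ j"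
  shows "threshold_dimension G \<le> card W"
proof -
  interpret pair_graph G by fact
  define D where "D v = {w \<in> W. (v, w) \<notin> parcs G}" for v
  have finW: "finite W" using W pair_finite_verts by (rule finite_subset)
  have "\<exists>C. inj_on C (pverts G - W) \<and> (\<forall>v \<in> pverts G - W. C v \<subseteq> D v)"
    using pair_finite_verts finW few by (intro distinct_subsets_exist) (auto simp: D_def)
  then obtain C where C: "inj_on C (pverts G - W)" "\<And>v. v \<in> pverts G - W \<Longrightarrow> C v \<subseteq> D v" by blast
  \<comment> \<open>\<open>W - C v\<close> already contains every neighbour of \<open>v\<close> in
    \<open>W\<close>, so it becomes exactly the neighbourhood of \<open>v\<close> in
    \<open>W\<close>.\<close>
  define N where "N = {(v, w). v \<in> pverts G - W \<and> w \<in> W - C v}"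
  define H where "H = \<lparr>pverts = pverts G, parcs = parcs G \<union> N \<union> N\<inverse>\<rparr>"
  have N: "N \<subseteq> (pverts G - W) \<times> W" by (auto simp: N_def)
  have "pair_graph H"
  proof
    show "finite (parcs H)"
      using pair_finite_arcs finite_subset[OF N] pair_finite_verts finW by (auto simp: H_def)
    have "sym (parcs G)" using pair_sym_arcs by (simp add: symmetric_def)
    then have "sym (parcs H)" by (auto simp: H_def sym_def)
    then show "symmetric (with_proj H)" by (simp add: symmetric_def)
  qed (use pair_finite_verts in_arcsD1 in_arcsD2 pair_no_loops N W in \<open>auto simp: H_def\<close>)
  moreover have "spanning (with_proj G) (with_proj H)"
  proof -
    interpret H: pair_graph H by fact
    show ?thesis
      using wf_digraph_axioms H.wf_digraph_axioms
      by (auto simp: spanning_def subgraph_def compatible_def H_def)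
  qed
  moreover have "resolving_set H W"
  proof (rule resolving_setI)
    have *: "{w \<in> W. (v, w) \<in> parcs H} = W - C v" if "v \<in> pverts G - W" for v
      using that C(2)[OF that] by (auto simp: H_def N_def D_def)
    show "{w \<in> W. (u, w) \<in> parcs H} \<noteq> {w \<in> W. (v, w) \<in> parcs H}"
      if uv: "u \<in> pverts H - W" "v \<in> pverts H - W" "u \<noteq> v" for u v
    proof
      have mem: "u \<in> pverts G - W" "v \<in> pverts G - W" using uv by (auto simp: H_def)
      assume "{w \<in> W. (u, w) \<in> parcs H} = {w \<in> W. (v, w) \<in> parcs H}"
      then have "W - C u = W - C v" using *[OF mem(1)] *[OF mem(2)] by simp
      then have "C u = C v" using C(2)[OF mem(1)] C(2)[OF mem(2)] unfolding D_def by blast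
      then show False using C(1) mem uv(3) by (auto simp: inj_on_def)
    qed
  qed (use \<open>pair_graph H\<close> W in \<open>auto simp: H_def\<close>)
  ultimately show ?thesis by (rule threshold_dimension_le)
qed

section \<open>The function \<open>f_thr\<close> and the logarithm\<close>

lemma f_thr_less: "x < 2 ^ f_thr x + real (f_thr x)"
proof -
  obtain d where "x < real d" using reals_Archimedean2 by blast
  then have "x < 2 ^ d + real d" by (smt (verit) zero_le_power)
  then show ?thesis unfolding f_thr_def by (rule LeastI)
qed

lemma f_thr_le: "x < 2 ^ d + real d \<Longrightarrow> f_thr x \<le> d"
  unfolding f_thr_def by (rule Least_le)

text \<open>With \<open>d = L - 2\<close>, the bound \<open>n \<le> 2 ^ L\<close> gives
  \<open>n / 4 \<le> 2 ^ d\<close>, and the summand \<open>d\<close> makes this strict unless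
  \<open>d = 0\<close>. In that case only \<open>n = 3\<close> remains; at \<open>n = 4\<close> the
  left side would be 1 and the right side 0.\<close>

lemma f_thr_quarter_le_log:
  assumes "n \<ge> 3" "n \<noteq> 4"
  shows "int (f_thr (real n / 4)) \<le> \<lceil>log 2 (real n)\<rceil> - 2"
proof -
  define L where "L = nat \<lceil>log 2 (real n)\<rceil>"
  have "log 2 (real n) > 1" using assms(1) by (subst less_log_iff) auto
  then have L: "int L = \<lceil>log 2 (real n)\<rceil>" "L \<ge> 2" by (simp_all add: L_def) linarith+
  have "log 2 (real n) \<le> real L"
    using L(1) by (metis le_of_int_ceiling of_int_of_nat_eq)
  then have n: "real n \<le> 2 ^ L"
    using assms(1) by (simp add: log_le_iff powr_realpow)
  obtain d where d: "L = d + 2" using L(2) by (metis add.commute le_Suc_ex)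
  have "real n / 4 < 2 ^ d + real d"
  proof (cases "d = 0")
    case True
    then show ?thesis using n d assms by auto
  next
    case False
    then show ?thesis using n d by simp
  qed
  then have "f_thr (real n / 4) \<le> d" by (rule f_thr_le)
  then show ?thesis using L d by linarith
qed

section \<open>Graphs without \<open>K\<^sub>3\<^sub>,\<^sub>3\<close>\<close>

lemma three_distinct_elements:
  assumes "card T \<ge> 3"
  obtains x y z where "x \<in> T" "y \<in> T" "z \<in> T" "x \<noteq> y" "x \<noteq> z" "y \<noteq> z"
proof -
  obtain S where "S \<subseteq> T" "card S = 3" using obtain_subset_with_card_n[OF assms] by metis
  moreover from this(2) obtain x y z where "S = {x, y, z}" "x \<noteq> y" "x \<noteq> z" "y \<noteq> z"
    unfolding card_3_iff by blast
  ultimately show ?thesis using that[of x y z] by simp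
qed

text \<open>Three vertices of \<open>U\<close> have at most two common neighbours in
  \<open>W\<close>, so their sets of non-neighbours together cover at least \<open>4 * k + 1\<close>
  of its \<open>4 * k + 3\<close> elements.\<close>

lemma few_nonneighbours:
  fixes E :: "'a rel" and k :: nat
  defines "D \<equiv> \<lambda>W v. {w \<in> W. (v, w) \<notin> E}"
  assumes fin: "finite U" "finite W" and disj: "U \<inter> W = {}"
    and cW: "card W = 4 * k + 3" and cU: "card U \<le> 4 * 2 ^ k - 4" and k: "k \<ge> 1"
    and K33: "\<And>A B. card A = 3 \<Longrightarrow> card B = 3 \<Longrightarrow> A \<inter> B = {} \<Longrightarrow> A \<times> B \<subseteq> E \<Longrightarrow> False"
    and full: "card {v \<in> U. D W v = {}} \<le> 1"
  shows "card {v \<in> U. card (D W v) \<le> j} \<le> 2 ^ j"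
proof -
  let ?D = "D W"
  define T where "T = {v \<in> U. card (?D v) \<le> j}"
  have finD: "finite (?D v)" for v using fin by (simp add: D_def)
  have finT: "finite T" "card T \<le> card U"
    using fin by (auto simp: T_def intro: card_mono)
  have union3: "card (?D x \<union> ?D y \<union> ?D z) \<ge> 4 * k + 1"
    if "x \<in> U" "y \<in> U" "z \<in> U" "x \<noteq> y" "x \<noteq> z" "y \<noteq> z" for x y z
  proof (rule ccontr)
    assume "\<not> ?thesis"
    moreover have "card (W - (?D x \<union> ?D y \<union> ?D z)) = card W - card (?D x \<union> ?D y \<union> ?D z)"
      using finD by (intro card_Diff_subset) (auto simp: D_def)
    ultimately have "3 \<le> card (W - (?D x \<union> ?D y \<union> ?D z))" using cW by simp
    then obtain B where B: "B \<subseteq> W - (?D x \<union> ?D y \<union> ?D z)" "card B = 3"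
      using obtain_subset_with_card_n by metis
    have "{x, y, z} \<times> B \<subseteq> E" using B(1) by (auto simp: D_def)
    then show False using K33[of "{x, y, z}" B] B that disj by auto
  qed
  have le3: "card (X \<union> Y \<union> Z) \<le> card X + card Y + card Z" for X Y Z :: "'a set"
    by (meson add_right_mono card_Un_le order.trans)
  \<comment> \<open>The size of \<open>U\<close> settles \<open>j \<ge> k + 2\<close>. In the third
    case three sets of size at most \<open>j\<close> cannot cover enough, so \<open>T\<close> has at
    most two elements. The last case forces \<open>4 * k + 1 \<le> 3 * k + 3\<close>, that is
    \<open>k \<le> 2\<close>.\<close>
  consider "j = 0" | "j \<ge> k + 2" | "1 \<le> j" "3 * j < 4 * k + 1"
    | "1 \<le> j" "j \<le> k + 1" "3 * j \<ge> 4 * k + 1" by linarith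
  then have "card T \<le> 2 ^ j"
  proof cases
    case 1
    then show ?thesis using full finD by (simp add: T_def)
  next
    case 2
    have "card T \<le> 2 ^ (k + 2)" using finT cU by simp
    also have "\<dots> \<le> 2 ^ j" using 2 by (intro power_increasing) auto
    finally show ?thesis .
  next
    case 3
    have "\<not> card T \<ge> 3"
    proof
      assume "card T \<ge> 3"
      then obtain x y z where "x \<in> T" "y \<in> T" "z \<in> T" "x \<noteq> y" "x \<noteq> z" "y \<noteq> z"
        by (rule three_distinct_elements)
      then show False using union3[of x y z] le3[of "?D x" "?D y" "?D z"] 3 by (auto simp: T_def)
    qed
    moreover have "(2::nat) ^ 1 \<le> 2 ^ j" using 3 by (intro power_increasing) auto
    ultimately show ?thesis by simp
  next
    case 4
    txt \<open>In the case \<open>k = 2\<close>, any three of the sets \<open>?D v\<close> with \<open>v \<in> T\<close> have at most three elements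
      each and at least nine together, so they are pairwise disjoint; but \<open>W\<close> has only eleven.\<close>
    then consider "k = 1" "j = 2" | "k = 2" "j = 3" using k by linarith
    then show ?thesis
    proof cases
      case 1
      then show ?thesis using finT cU by simp
    next
      case 2
      have "\<not> card T \<ge> 4"
      proof
        assume "card T \<ge> 4"
        then have "T \<noteq> {}" by auto
        then obtain x where x: "x \<in> T" by blast
        with \<open>card T \<ge> 4\<close> have "card (T - {x}) \<ge> 3" using finT by simp
        then obtain a b c where abc: "a \<in> T - {x}" "b \<in> T - {x}" "c \<in> T - {x}"
            "a \<noteq> b" "a \<noteq> c" "b \<noteq> c"
          by (rule three_distinct_elements)
        have small: "card (?D v) \<le> 3" "v \<in> U" if "v \<in> T" for v using that 2 by (auto simp: T_def)
        have "?D u \<inter> ?D x = {} \<and> card (?D x) = 3"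
          if "u \<in> T - {x}" "v \<in> T - {x}" "u \<noteq> v" for u v
        proof -
          have "9 \<le> card (?D u \<union> ?D x \<union> ?D v)" using union3[of u x v] small that x 2 by auto
          also have "\<dots> \<le> card (?D u \<union> ?D x) + card (?D v)" by (rule card_Un_le)
          finally have "6 \<le> card (?D u \<union> ?D x)" using small[of v] that by auto
          moreover have "card (?D u) + card (?D x) = card (?D u \<union> ?D x) + card (?D u \<inter> ?D x)"
            using finD by (intro card_Un_Int)
          ultimately have "card (?D u \<inter> ?D x) = 0" "card (?D x) = 3"
            using small[of u] small[of x] that x by auto
          then show ?thesis using finD by auto
        qed
        then have "(?D a \<union> ?D b \<union> ?D c) \<inter> ?D x = {}" "card (?D x) = 3"
          using abc by blast+
        moreover have "9 \<le> card (?D a \<union> ?D b \<union> ?D c)" using union3[of a b c] small abc 2 by auto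
        ultimately have "12 \<le> card (?D a \<union> ?D b \<union> ?D c \<union> ?D x)"
          using finD by (subst card_Un_disjoint) auto
        also have "\<dots> \<le> card W" using fin by (intro card_mono) (auto simp: D_def)
        finally show False using cW 2 by simp
      qed
      then show ?thesis using 2 by simp
    qed
  qed
  then show ?thesis by (simp add: T_def)
qed

text \<open>This serves the case \<open>j = 0\<close> of the counting condition: only one vertex may
  be assigned a subset of the empty set.\<close>

lemma exists_subset_few_full_neighbours:
  assumes fin: "finite V" and m: "4 \<le> m" "m \<le> card V"
    and K33: "\<And>A B. card A = 3 \<Longrightarrow> card B = 3 \<Longrightarrow> A \<inter> B = {} \<Longrightarrow> A \<times> B \<subseteq> E \<Longrightarrow> False"
  shows "\<exists>W \<subseteq> V. card W = m \<and> card {v \<in> V - W. {w \<in> W. (v, w) \<notin> E} = {}} \<le> 1"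
proof -
  let ?F = "\<lambda>W. {v \<in> V - W. {w \<in> W. (v, w) \<notin> E} = {}}"
  obtain W where W: "W \<subseteq> V" "card W = m" using obtain_subset_with_card_n[OF m(2)] by metis
  have finW: "finite W" using W fin finite_subset by blast
  txt \<open>If two vertices are adjacent to all of \<open>W\<close>, exchange one of them with an element of \<open>W\<close>.\<close>
  show ?thesis
  proof (cases "card (?F W) \<le> 1")
    case True
    then show ?thesis using W by blast
  next
    case False
    have two: "\<exists>x y. x \<in> X \<and> y \<in> X \<and> x \<noteq> y" if "\<not> card X \<le> 1" for X :: "'a set"
    proof -
      have "finite X" by (rule ccontr) (use that in simp)
      then show ?thesis using that card_le_Suc0_iff_eq[of X] by auto
    qed
    obtain u v where uv: "u \<in> ?F W" "v \<in> ?F W" "u \<noteq> v" using two[OF False] by blast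
    have "W \<noteq> {}" using W m by auto
    then obtain w where w: "w \<in> W" by blast
    define W' where "W' = insert u (W - {w})"
    have W': "W' \<subseteq> V" "card W' = m"
    proof -
      show "W' \<subseteq> V" using W uv(1) by (auto simp: W'_def)
      have "u \<notin> W - {w}" using uv(1) by blast
      then show "card W' = m" using W w finW m by (simp add: W'_def)
    qed
    have "card (?F W') \<le> 1"
    proof (rule ccontr)
      assume many: "\<not> ?thesis"
      obtain a b where ab: "a \<in> ?F W'" "b \<in> ?F W'" "a \<noteq> b" using two[OF many] by blast
      \<comment> \<open>All of \<open>u\<close>, \<open>v\<close>, \<open>y\<close> are adjacent to
        every element of \<open>W - {w}\<close>, which has at least three elements because
        \<open>m \<ge> 4\<close>.\<close>
      then obtain y where y: "y \<in> ?F W'" "y \<noteq> v" by (cases "a = v") simp_all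
      have "3 \<le> card (W - {w})" using W w m finW by simp
      then obtain B where B: "B \<subseteq> W - {w}" "card B = 3" using obtain_subset_with_card_n by metis
      have "y \<noteq> u" "y \<notin> B" using y B(1) by (auto simp: W'_def)
      then have "card {u, v, y} = 3" using uv(3) y(2) by simp
      moreover have "{u, v, y} \<inter> B = {}" using uv(1,2) \<open>y \<notin> B\<close> B(1) by blast
      moreover have "{u, v, y} \<times> B \<subseteq> E"
      proof -
        have "(x, b) \<in> E" if "x \<in> {u, v}" "b \<in> B" for x b
          using uv(1,2) B(1) that by blast
        moreover have "(y, b) \<in> E" if "b \<in> B" for b
          using y(1) B(1) that by (auto simp: W'_def)
        ultimately show ?thesis by blast
      qed
      ultimately show False using K33 B(2) by blast
    qed
    then show ?thesis using W' by blast
  qed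
qed

section \<open>Bounds on the threshold dimension\<close>

lemma threshold_dimension_K33_free:
  assumes G: "pair_graph G"
    and K33: "\<And>A B. card A = 3 \<Longrightarrow> card B = 3 \<Longrightarrow> A \<inter> B = {} \<Longrightarrow> A \<times> B \<subseteq> parcs G \<Longrightarrow> False"
    and n: "card (pverts G) < 4 * (2 ^ k + k)"
  shows "threshold_dimension G \<le> 4 * k + 3"
proof -
  interpret pair_graph G by fact
  have fin: "finite (pverts G)" by (rule pair_finite_verts)
  show ?thesis
  proof (cases "card (pverts G) \<le> 4 * k + 3")
    case True
    then show ?thesis
      using threshold_dimension_le_of_few_nonneighbours[OF G order.refl] by simp
  next
    case False
    \<comment> \<open>For \<open>k = 0\<close> there are fewer than four vertices, which is the
      previous case.\<close>
    then have k: "k \<ge> 1" using n by (cases k) auto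
    have "4 \<le> 4 * k + 3" "4 * k + 3 \<le> card (pverts G)" using k False by auto
    then have "\<exists>W \<subseteq> pverts G. card W = 4 * k + 3 \<and>
        card {v \<in> pverts G - W. {w \<in> W. (v, w) \<notin> parcs G} = {}} \<le> 1"
      by (rule exists_subset_few_full_neighbours[OF fin]) (rule K33)
    then obtain W where W: "W \<subseteq> pverts G" "card W = 4 * k + 3"
        "card {v \<in> pverts G - W. {w \<in> W. (v, w) \<notin> parcs G} = {}} \<le> 1"
      by blast
    have finW: "finite W" using W(1) fin finite_subset by blast
    have "card (pverts G - W) = card (pverts G) - card W"
      using W(1) finW by (intro card_Diff_subset)
    then have rest: "card (pverts G - W) \<le> 4 * 2 ^ k - 4" using n W(2) by simp
    have "card {v \<in> pverts G - W. card {w \<in> W. (v, w) \<notin> parcs G} \<le> j} \<le> 2 ^ j" for j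
    proof (rule few_nonneighbours[of "pverts G - W" W k "parcs G" j])
      show False if "card A = 3" "card B = 3" "A \<inter> B = {}" "A \<times> B \<subseteq> parcs G" for A B
        using that by (rule K33)
    qed (use fin finW W(2,3) k rest in auto)
    then show ?thesis
      using threshold_dimension_le_of_few_nonneighbours[OF G W(1)] W(2) by simp
  qed
qed

text \<open>All vertices but one form a suitable \<open>W\<close>, since a single vertex outside
  satisfies the counting condition trivially. This gives the bound 3 for graphs of order 4.\<close>

lemma threshold_dimension_less_order:
  assumes G: "pair_graph G" and "pverts G \<noteq> {}"
  shows "threshold_dimension G < card (pverts G)"
proof -
  interpret pair_graph G by fact
  obtain x where x: "x \<in> pverts G" using assms(2) by blast
  have "card {v \<in> pverts G - (pverts G - {x}). P v} \<le> 2 ^ j" for P and j :: nat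
  proof -
    have "card {v \<in> pverts G - (pverts G - {x}). P v} \<le> card {x}"
      by (intro card_mono) auto
    also have "\<dots> \<le> 2 ^ j" by simp
    finally show ?thesis .
  qed
  then have "threshold_dimension G \<le> card (pverts G - {x})"
    by (intro threshold_dimension_le_of_few_nonneighbours[OF G]) auto
  also have "\<dots> < card (pverts G)" using x pair_finite_verts by (intro psubset_card_mono) auto
  finally show ?thesis .
qed

lemma planar_threshold_dimension_le:
  assumes G: "pair_graph G" and "planar G"
  shows "threshold_dimension G \<le> 4 * f_thr (real (card (pverts G)) / 4) + 3"
proof (rule threshold_dimension_K33_free[OF G])
  interpret pair_graph G by fact
  have wf: "parcs G \<subseteq> pverts G \<times> pverts G" using in_arcsD1 in_arcsD2 by auto
  show False if "card A = 3" "card B = 3" "A \<inter> B = {}" "A \<times> B \<subseteq> parcs G" for A B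
    by (rule planar_no_K33[OF assms(2) wf that])
  define k where "k = f_thr (real (card (pverts G)) / 4)"
  have "real (card (pverts G)) / 4 < 2 ^ k + real k" unfolding k_def by (rule f_thr_less)
  then have "real (card (pverts G)) < real (4 * (2 ^ k + k))" by simp
  then show "card (pverts G) < 4 * (2 ^ f_thr (real (card (pverts G)) / 4) + f_thr (real (card (pverts G)) / 4))"
    unfolding k_def by (simp only: of_nat_less_iff)
qed

text \<open>At \<open>n = 4\<close> the bound through \<open>f_thr\<close> is 7 while the
  logarithmic one is 3, so the two are not comparable as claimed, but the outer inequality survives.
  For \<open>n = 1\<close> and \<open>n = 2\<close> the logarithmic bound is negative.\<close>

theorem corollary3p6:
  fixes G :: "'a pair_pre_digraph" and n :: nat
  assumes "pair_graph G"
    and "planar G"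
    and "card (pverts G) = n"
  shows "int (threshold_dimension G) \<le> 4 * (int (f_thr (real n / 4)) + 1) - 1 \<and>
    (n \<ge> 3 \<and> n \<noteq> 4 \<longrightarrow>
       4 * (int (f_thr (real n / 4)) + 1) - 1 \<le> 4 * \<lceil>log 2 (real n)\<rceil> - 5) \<and>
    (n \<ge> 3 \<longrightarrow> int (threshold_dimension G) \<le> 4 * \<lceil>log 2 (real n)\<rceil> - 5)"
proof -
  have tau: "int (threshold_dimension G) \<le> 4 * (int (f_thr (real n / 4)) + 1) - 1"
    using planar_threshold_dimension_le[OF assms(1,2)] assms(3) by simp
  have f: "4 * (int (f_thr (real n / 4)) + 1) - 1 \<le> 4 * \<lceil>log 2 (real n)\<rceil> - 5"
    if "n \<ge> 3 \<and> n \<noteq> 4"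
  proof -
    have "int (f_thr (real n / 4)) \<le> \<lceil>log 2 (real n)\<rceil> - 2"
      using that by (intro f_thr_quarter_le_log) auto
    then show ?thesis by simp
  qed
  have "int (threshold_dimension G) \<le> 4 * \<lceil>log 2 (real n)\<rceil> - 5" if "n \<ge> 3"
  proof (cases "n = 4")
    case True
    have "log 2 (real n) = 2" using True log_nat_power[of 2 2 2] by simp
    moreover have "threshold_dimension G < 4"
      using threshold_dimension_less_order[OF assms(1)] assms(3) True by force
    ultimately show ?thesis by simp
  next
    case False
    then show ?thesis using order.trans[OF tau f] that by blast
  qed
  then show ?thesis using tau f by blast
qed

end
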